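(* Let $a\geq 3$ be an odd integer and consider the self-similar Sierpinski carpet $S_a$. Let $k\geq 0$ and let $S_{a,k}$ be the $k$th prefractal approximation of $S_a$. Let $\alpha\in B_a$ and $x_k^0=\left(\frac{p}{2a^k},0\right)$ with $p\leq a^k$ a positive odd integer. If $\mathscr{O}_k(x_k^0,\alpha_k^0)$, with $\alpha_k^0=\alpha$, is an orbit of $\Omega(S_{a,k})$, then the initial condition $(x_k^0,\alpha_k^0)$ determines a sequence of compatible periodic orbits $\{\mathscr{O}_n(x_n^0,\alpha^0)\}_{n=k}^\infty$ of the prefractal approximations $\Omega(S_{a,n})$, $n\ge k$.
   Context: **Carpets.** Let $a=2j+1$ with $j$ a positive integer. $S_{a,0}=S_0$ is the unit square $[0,1]^2$. $S_{a,n+1}$ is obtained from $S_{a,n}$ by dividing each of the remaining subsquares of side-length $a^{-n}$ into $a^2$ equal squares of side-length $a^{-(n+1)}$ and removing the open middle one. $S_a=\bigcap_{n\ge0}S_{a,n}$. The boundary of a removed open square is called a peripheral square. **Slopes.** $$B_a=\left\{\tfrac{p}{q}:\ p+q\leq a-1,\ 0\leq p\leq q\leq a-2,\ p,q\in\mathbb{N},\ p,q\text{ odd}\right\}.$$ **Billiards.** $\Omega(S_{a,n})$ is the billiard table consisting of the unit square with the peripheral squares of $S_{a,n}$ as obstacles: a point moves at unit speed in straight lines in $S_{a,n}$ and reflects by the law of reflection off the sides of the unit square and of the peripheral squares. Reflection is defined at the corners of the unit square (interior angle $\pi/2$; the trajectory comes back along the path on which it arrived), while a trajectory hitting a corner of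 a peripheral square is singular and terminates. An initial condition is written $(x_n^0,\alpha_n^0)$, where $x_n^0$ is a boundary point and $\alpha_n^0=\tan\theta_n^0$ with $\theta_n^0$ the inward pointing initial direction; $\mathscr{O}_n(x_n^0,\alpha_n^0)$ is the resulting orbit. With $f_n$ the billiard map (next collision point and reflected direction), the orbit is periodic if reflection is well defined at all its basepoints and $f_n^m$ fixes the initial condition for some $m\ge1$. **Compatible orbits.** For $n>m$, initial conditions $(x_n^0,\theta_n^0)$ of $\Omega(S_{a,n})$ and $(x_m^0,\theta_m^0)$ of $\Omega(S_{a,m})$, both inward pointing, are compatible if $\theta_n^0=\theta_m^0$ and $x_n^0,x_m^0$ lie on a segment in this direction that meets the boundary of $\Omega(S_{a,n})$ only at $x_n^0$. A sequence of compatible orbits $\{\mathscr{O}_n(x_n^0,\alpha^0)\}_{n=k}^\infty$ is a sequence of orbits of $\Omega(S_{a,n})$ whose initial conditions are pairwise compatible; it is determined by its first initial condition. It is a sequence of compatible periodic orbits if every orbit in it is periodic. *)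

theory Defs
  imports "HOL-Analysis.Analysis"
begin

type_synonym point = "real \<times> real"

text \<open>A basepoint together with a direction, the latter given as a unit vector
  \<open>(cos \<theta>, sin \<theta>)\<close>, so that directions are angles modulo \<open>2 * pi\<close>.\<close>
type_synonym phase = "point \<times> point"


subsection \<open>Prefractals of the self-similar carpet\<close>

definition grid_point :: "nat \<Rightarrow> nat \<Rightarrow> nat \<Rightarrow> nat \<Rightarrow> point" where
  "grid_point a n i j = (real i / real (a ^ n), real j / real (a ^ n))"

text \<open>\<open>(i, j) \<in> subsquares a n\<close> stands for the remaining subsquare of side \<open>1 / a ^ n\<close> of the
  \<open>n\<close>-th prefractal whose lower left corner is \<open>grid_point a n i j\<close>. For odd \<open>a\<close>, the middle one
  of its \<open>a * a\<close> parts is the one in column and row \<open>a div 2\<close> (counting from 0).\<close>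
primrec subsquares :: "nat \<Rightarrow> nat \<Rightarrow> (nat \<times> nat) set" where
  "subsquares a 0 = {(0, 0)}"
| "subsquares a (Suc n) =
     {(a * i + r, a * j + s) | i j r s.
        (i, j) \<in> subsquares a n \<and> r < a \<and> s < a \<and> (r, s) \<noteq> (a div 2, a div 2)}"

text \<open>The squares removed in passing from stage \<open>n\<close> to stage \<open>n + 1\<close>, each represented by its
  lower left and its upper right corner.\<close>
definition removed :: "nat \<Rightarrow> nat \<Rightarrow> (point \<times> point) set" where
  "removed a n =
     {(grid_point a (Suc n) (a * i + a div 2) (a * j + a div 2),
       grid_point a (Suc n) (a * i + a div 2 + 1) (a * j + a div 2 + 1)) | i j.
        (i, j) \<in> subsquares a n}"

primrec prefractal :: "nat \<Rightarrow> nat \<Rightarrow> point set" where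
  "prefractal a 0 = cbox (0, 0) (1, 1)"
| "prefractal a (Suc n) = prefractal a n - (\<Union>(l, u)\<in>removed a n. box l u)"


subsection \<open>Slopes\<close>

definition slopes :: "nat \<Rightarrow> real set" where
  "slopes a = {real p / real q | p q.
     p + q \<le> a - 1 \<and> 0 \<le> p \<and> p \<le> q \<and> q \<le> a - 2 \<and> odd p \<and> odd q}"


subsection \<open>Billiards in a prefractal\<close>

definition obstacles :: "nat \<Rightarrow> nat \<Rightarrow> (point \<times> point) set" where
  "obstacles a n = (\<Union>m<n. removed a m)"

definition walls :: "nat \<Rightarrow> nat \<Rightarrow> (point \<times> point) set" where
  "walls a n = insert ((0, 0), (1, 1)) (obstacles a n)"

definition table_boundary :: "nat \<Rightarrow> nat \<Rightarrow> point set" where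
  "table_boundary a n = (\<Union>(l, u)\<in>walls a n. frontier (box l u))"

fun horizontal_sides :: "point \<times> point \<Rightarrow> point set" where
  "horizontal_sides ((l1, l2), (u1, u2)) = {l1..u1} \<times> {l2, u2}"

fun vertical_sides :: "point \<times> point \<Rightarrow> point set" where
  "vertical_sides ((l1, l2), (u1, u2)) = {l1, u1} \<times> {l2..u2}"

definition peripheral_corners :: "nat \<Rightarrow> nat \<Rightarrow> point set" where
  "peripheral_corners a n = (\<Union>s\<in>obstacles a n. horizontal_sides s \<inter> vertical_sides s)"

text \<open>A horizontal side reverses the vertical component of the direction, a vertical side the
  horizontal component. At a corner of the unit square both are reversed, so that the trajectory
  returns along the path on which it arrived. The value at a peripheral corner is never used.\<close>
definition reflect :: "nat \<Rightarrow> nat \<Rightarrow> point \<Rightarrow> point \<Rightarrow> point" where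
  "reflect a n x v =
     (if x \<in> (\<Union>s\<in>walls a n. vertical_sides s) then - fst v else fst v,
      if x \<in> (\<Union>s\<in>walls a n. horizontal_sides s) then - snd v else snd v)"

definition initial_condition :: "nat \<Rightarrow> nat \<Rightarrow> phase \<Rightarrow> bool" where
  "initial_condition a n z \<longleftrightarrow>
     (case z of (x, v) \<Rightarrow> x \<in> table_boundary a n \<and> norm v = 1 \<and>
       (\<exists>\<epsilon>>0. \<forall>t. 0 < t \<and> t < \<epsilon> \<longrightarrow> x + t *\<^sub>R v \<in> prefractal a n - table_boundary a n))"

text \<open>For an inward pointing direction the infimum is attained at a positive time.\<close>
definition next_collision :: "nat \<Rightarrow> nat \<Rightarrow> phase \<Rightarrow> point" where
  "next_collision a n z =
     (case z of (x, v) \<Rightarrow> x + Inf {t. 0 < t \<and> x + t *\<^sub>R v \<in> table_boundary a n} *\<^sub>R v)"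

definition billiard_map :: "nat \<Rightarrow> nat \<Rightarrow> phase \<Rightarrow> phase option" where
  "billiard_map a n z =
     (let y = next_collision a n z
      in if y \<in> peripheral_corners a n then None else Some (y, reflect a n y (snd z)))"

text \<open>The \<open>i\<close>-th iterate of the billiard map; \<open>None\<close> once the trajectory has terminated in a
  peripheral corner.\<close>
primrec orbit :: "nat \<Rightarrow> nat \<Rightarrow> phase \<Rightarrow> nat \<Rightarrow> phase option" where
  "orbit a n z 0 = Some z"
| "orbit a n z (Suc i) = Option.bind (orbit a n z i) (billiard_map a n)"

definition periodic_orbit :: "(nat \<Rightarrow> phase option) \<Rightarrow> bool" where
  "periodic_orbit orb \<longleftrightarrow> (\<forall>i. orb i \<noteq> None) \<and> (\<exists>m\<ge>1. orb m = orb 0)"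


subsection \<open>Compatible orbits\<close>

definition compatible :: "nat \<Rightarrow> nat \<Rightarrow> nat \<Rightarrow> phase \<Rightarrow> phase \<Rightarrow> bool" where
  "compatible a n m zn zm \<longleftrightarrow>
     initial_condition a n zn \<and> initial_condition a m zm \<and> snd zn = snd zm \<and>
     (\<exists>c s. 0 < s \<and> {fst zn, fst zm} \<subseteq> closed_segment c (c + s *\<^sub>R snd zn) \<and>
        closed_segment c (c + s *\<^sub>R snd zn) \<inter> table_boundary a n = {fst zn})"

text \<open>Only the entries with index at least \<open>k\<close> of the sequence \<open>orb\<close> matter.\<close>
definition compatible_orbits :: "nat \<Rightarrow> nat \<Rightarrow> (nat \<Rightarrow> nat \<Rightarrow> phase option) \<Rightarrow> bool" where
  "compatible_orbits a k orb \<longleftrightarrow>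
     (\<exists>z. (\<forall>n\<ge>k. initial_condition a n (z n) \<and> orb n = orbit a n (z n)) \<and>
          (\<forall>m n. k \<le> m \<and> m < n \<longrightarrow> compatible a n m (z n) (z m)))"

definition compatible_periodic_orbits :: "nat \<Rightarrow> nat \<Rightarrow> (nat \<Rightarrow> nat \<Rightarrow> phase option) \<Rightarrow> bool" where
  "compatible_periodic_orbits a k orb \<longleftrightarrow>
     compatible_orbits a k orb \<and> (\<forall>n\<ge>k. periodic_orbit (orb n))"

end

theory Submission
  imports Defs
begin

text \<open>
  The point is a parity obstruction. Measure lengths in cells of side \<open>1 / h\<close>, where \<open>h = a ^ n\<close>:
  all corners of walls of the \<open>n\<close>-th prefractal become integer points, and since \<open>a\<close> is odd, the
  starting point \<open>p / (2 * a ^ k)\<close> is still the midpoint of a cell side for every \<open>n \<ge> k\<close>. A line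
  from such a midpoint with slope \<open>P / Q\<close>, both \<open>P\<close> and \<open>Q\<close> odd, has an equation
  \<open>2 * h * (Q * y - P * x) = N\<close> with \<open>N\<close> an odd integer, whereas the left-hand side is even at
  every integer point; so the line misses all corners. A reflection in a vertical or horizontal grid
  line changes the signs of \<open>P\<close> or \<open>Q\<close> and \<open>N\<close>, and shifts \<open>N\<close> by a multiple of 4, hence the equation
  keeps its shape (\<open>odd_line_reflect_vertical\<close>, \<open>odd_line_reflect_horizontal\<close>) and the orbit is
  never singular (\<open>odd_line_billiard_map\<close>).

  Periodicity is then pure finiteness: a collision point lies on the grid and on a line with an
  equation as above, so its coordinates have a bounded denominator, and only finitely many phases
  are possible (\<open>finite_odd_line_phases\<close>). The billiard map is injective on them, because a
  trajectory can be retraced backwards (\<open>billiard_map_inj\<close>), and an injective self-map of a finite set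
  has only periodic orbits.

  The sequence of compatible orbits is the constant one. The starting point lies on the bottom side
  of the unit square, which is a wall of every table and keeps away from all removed squares, so the
  same phase is an initial condition at every stage (\<open>bottom_phase\<close>); and compatibility with a
  phase whose basepoint is already a boundary point of the finer table forces equality
  (\<open>compatible_unique\<close>).
\<close>


section \<open>Geometry of the walls\<close>

lemma finite_subsquares: "finite (subsquares a n)"
proof (induction n)
  case (Suc n)
  have "subsquares a (Suc n) \<subseteq>
    (\<lambda>((i, j), (r, s)). (a * i + r, a * j + s)) ` (subsquares a n \<times> ({..<a} \<times> {..<a}))"
    by force
  then show ?case
    using Suc by (meson finite_SigmaI finite_imageI finite_lessThan finite_subset)
qed simp

lemma finite_walls: "finite (walls a n)"
proof -
  have "removed a m = (\<lambda>(i, j).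
      (grid_point a (Suc m) (a * i + a div 2) (a * j + a div 2),
       grid_point a (Suc m) (a * i + a div 2 + 1) (a * j + a div 2 + 1))) ` subsquares a m" for m
    by (auto simp: removed_def)
  then show ?thesis
    by (simp add: walls_def obstacles_def finite_subsquares)
qed

lemma closed_table_boundary: "closed (table_boundary a n)"
  unfolding table_boundary_def by (rule closed_UN) (auto simp: finite_walls)

lemma grid_point_refine:
  assumes "a \<ge> 1" "m \<le> n"
  shows "grid_point a m i j = grid_point a n (i * a ^ (n - m)) (j * a ^ (n - m))"
proof -
  have "a ^ n = a ^ m * a ^ (n - m)"
    using assms(2) by (metis le_add_diff_inverse power_add)
  then show ?thesis
    using assms(1) by (simp add: grid_point_def)
qed

text \<open>The corners are grid points already at an earlier stage, and the grids of successive stages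
  are nested. The middle cell of a subdivided square is not in its bottom row, so an obstacle never
  reaches down to the bottom side of the unit square; this is the condition \<open>0 < j\<close>.\<close>
lemma obstacle_corners:
  assumes "a \<ge> 3" "(l, u) \<in> obstacles a n"
  obtains i j i' j' where "l = grid_point a n i j" "u = grid_point a n i' j'"
    "0 < j" "i < i'" "j < j'"
proof -
  obtain m i j where m: "m < n" and
    lu: "l = grid_point a (Suc m) (a * i + a div 2) (a * j + a div 2)"
      "u = grid_point a (Suc m) (a * i + a div 2 + 1) (a * j + a div 2 + 1)"
    using assms(2) by (auto simp: obstacles_def removed_def)
  have "0 < a ^ (n - Suc m)" "0 < a div 2"
    using assms(1) by auto
  then show thesis
    using that[of "(a * i + a div 2) * a ^ (n - Suc m)" "(a * j + a div 2) * a ^ (n - Suc m)"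
        "(a * i + a div 2 + 1) * a ^ (n - Suc m)" "(a * j + a div 2 + 1) * a ^ (n - Suc m)"]
      grid_point_refine[of a "Suc m" n] m assms(1) lu by auto
qed

lemma wall_corners:
  assumes "a \<ge> 3" "(l, u) \<in> walls a n"
  obtains i j i' j' where "l = grid_point a n i j" "u = grid_point a n i' j'" "i < i'" "j < j'"
proof (cases "(l, u) \<in> obstacles a n")
  case True
  then show ?thesis
    using that obstacle_corners[OF assms(1)] by metis
next
  case False
  then have "l = grid_point a n 0 0" "u = grid_point a n (a ^ n) (a ^ n)"
    using assms by (auto simp: walls_def grid_point_def)
  then show ?thesis
    using that[of 0 0 "a ^ n" "a ^ n"] assms(1) by auto
qed

lemma box_Pair_eq: "box (l1, l2) (u1, u2) = {l1<..<u1} \<times> {l2<..<(u2::real)}" for l1 u1 :: real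
  by (auto simp: box_def Basis_prod_def)

lemma frontier_box_sides:
  assumes "l1 < u1" "l2 < (u2::real)"
  shows "frontier (box (l1, l2) (u1, u2)) =
    horizontal_sides ((l1, l2), (u1, u2)) \<union> vertical_sides ((l1, l2), (u1, u2))"
proof -
  have "box (l1, l2) (u1, u2) \<noteq> {}"
    using assms by (auto simp: box_Pair_eq)
  then have "frontier (box (l1, l2) (u1, u2)) = cbox (l1, l2) (u1, u2) - box (l1, l2) (u1, u2)"
    by (simp add: frontier_box)
  also have "\<dots> = horizontal_sides ((l1, l2), (u1, u2)) \<union> vertical_sides ((l1, l2), (u1, u2))"
    using assms by (auto simp: box_Pair_eq cbox_Pair_eq)
  finally show ?thesis .
qed

lemma table_boundary_sides:
  assumes "a \<ge> 3"
  shows "table_boundary a n =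
    (\<Union>s\<in>walls a n. horizontal_sides s) \<union> (\<Union>s\<in>walls a n. vertical_sides s)"
proof -
  have "frontier (box l u) = horizontal_sides (l, u) \<union> vertical_sides (l, u)"
    if lu: "(l, u) \<in> walls a n" for l u
  proof -
    obtain i j i' j' where "l = grid_point a n i j" "u = grid_point a n i' j'" "i < i'" "j < j'"
      using wall_corners[OF assms lu] by metis
    then show ?thesis
      using assms by (simp add: grid_point_def frontier_box_sides divide_strict_right_mono)
  qed
  then have "table_boundary a n = (\<Union>s\<in>walls a n. horizontal_sides s \<union> vertical_sides s)"
    unfolding table_boundary_def by (intro SUP_cong) auto
  then show ?thesis
    by (simp only: UN_Un_distrib)
qed

lemma vertical_sides_on_grid:
  assumes "a \<ge> 3" "x \<in> (\<Union>s\<in>walls a n. vertical_sides s)"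
  shows "a ^ n * fst x \<in> \<int>"
proof -
  obtain l u where lu: "(l, u) \<in> walls a n" "x \<in> vertical_sides (l, u)"
    using assms(2) by auto
  obtain i j i' j' where "l = grid_point a n i j" "u = grid_point a n i' j'"
    using wall_corners[OF assms(1) lu(1)] by metis
  then show ?thesis
    using lu(2) assms(1) by (auto simp: grid_point_def)
qed

lemma horizontal_sides_on_grid:
  assumes "a \<ge> 3" "x \<in> (\<Union>s\<in>walls a n. horizontal_sides s)"
  shows "a ^ n * snd x \<in> \<int>"
proof -
  obtain l u where lu: "(l, u) \<in> walls a n" "x \<in> horizontal_sides (l, u)"
    using assms(2) by auto
  obtain i j i' j' where "l = grid_point a n i j" "u = grid_point a n i' j'"
    using wall_corners[OF assms(1) lu(1)] by metis
  then show ?thesis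
    using lu(2) assms(1) by (auto simp: grid_point_def)
qed

lemma frontier_unit_square:
  "frontier (box (0, 0) (1, 1)) = cbox (0, 0) (1, 1) - box ((0, 0)::point) (1, 1)"
  by (simp add: frontier_box) (auto simp: box_Pair_eq)

lemma frontier_unit_square_subset: "frontier (box (0, 0) (1, 1)) \<subseteq> table_boundary a n"
  unfolding table_boundary_def walls_def by blast

lemma unit_square_diff_boundary:
  "cbox (0, 0) (1, 1) - table_boundary a n \<subseteq> box (0, 0) (1, 1)"
proof
  fix x assume x: "x \<in> cbox (0, 0) (1, 1) - table_boundary a n"
  then have "x \<notin> frontier (box (0, 0) (1, 1))"
    using frontier_unit_square_subset[of a n] by (meson DiffD2 subsetD)
  with x show "x \<in> box (0, 0) (1, 1)"
    by (simp only: frontier_unit_square Diff_iff) simp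
qed

lemma prefractal_obstacles:
  "prefractal a n = cbox (0, 0) (1, 1) - (\<Union>(l, u)\<in>obstacles a n. box l u)"
proof (induction n)
  case (Suc n)
  have "obstacles a (Suc n) = obstacles a n \<union> removed a n"
    by (auto simp: obstacles_def less_Suc_eq)
  then show ?case
    by (simp only: prefractal.simps Suc UN_Un Diff_eq Compl_Un Int_assoc)
qed (simp add: obstacles_def)


section \<open>Inward pointing phases\<close>

text \<open>Phases from which the next collision is well defined: the ray from the basepoint stays for a
  short time in the open unit square and off all walls. It may start on either side of the wall of
  an obstacle, and the basepoint may be a corner; this class of phases is preserved by reflection
  for directions that are not parallel to the axes (\<open>inward_reflect\<close>).\<close>
definition inward :: "nat \<Rightarrow> nat \<Rightarrow> phase \<Rightarrow> bool" where
  "inward a n z \<longleftrightarrow>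
     (case z of (x, v) \<Rightarrow> x \<in> table_boundary a n \<and> x \<in> cbox (0, 0) (1, 1) \<and>
       (\<forall>\<^sub>F t in at_right 0. x + t *\<^sub>R v \<in> box (0, 0) (1, 1) - table_boundary a n))"

definition hitting_times :: "nat \<Rightarrow> nat \<Rightarrow> phase \<Rightarrow> real set" where
  "hitting_times a n z = {t. 0 < t \<and> fst z + t *\<^sub>R snd z \<in> table_boundary a n}"

lemma next_collision_hitting_times:
  "next_collision a n z = fst z + Inf (hitting_times a n z) *\<^sub>R snd z"
  by (simp add: next_collision_def hitting_times_def split: prod.splits)

text \<open>The ray must leave the unit square and the boundary is closed, so there is a first hitting
  time; it is positive because the ray starts off the walls. Up to that time the ray cannot cross the
  frontier of the unit square, hence the collision point lies in the square.\<close>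
lemma inward_first_hit:
  assumes "inward a n z" "fst (snd z) \<noteq> 0"
  obtains T where "T > 0" "Inf (hitting_times a n z) = T" "T \<in> hitting_times a n z"
    "\<And>t. t \<in> hitting_times a n z \<Longrightarrow> T \<le> t" "next_collision a n z \<in> cbox (0, 0) (1, 1)"
proof -
  obtain x v where z: "z = (x, v)" by (cases z)
  let ?H = "hitting_times a n z" and ?T = "Inf (hitting_times a n z)"
  let ?ray = "\<lambda>t. x + t *\<^sub>R v"
  obtain \<epsilon> where "\<epsilon> > 0" and \<epsilon>: "\<And>t. 0 < t \<Longrightarrow> t < \<epsilon> \<Longrightarrow>
      ?ray t \<in> box (0, 0) (1, 1) - table_boundary a n"
    using assms(1) unfolding inward_def z eventually_at_right_field by auto
  have H_ge: "\<epsilon> \<le> t" if "t \<in> ?H" for t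
    using that \<epsilon>[of t] by (force simp: hitting_times_def z)
  have "?H = {t. \<epsilon> \<le> t} \<inter> ?ray -` table_boundary a n"
    using H_ge \<open>\<epsilon> > 0\<close> by (auto simp: hitting_times_def z)
  moreover have "closed (?ray -` table_boundary a n)"
    by (intro continuous_closed_vimage closed_table_boundary) (auto intro!: continuous_intros)
  moreover have "closed {t. \<epsilon> \<le> t}"
    using closed_atLeast[of \<epsilon>] by (simp add: atLeast_def)
  ultimately have "closed ?H" by auto
  have bdd: "bdd_below ?H"
    using H_ge by (meson bdd_below.I)
  \<comment> \<open>A ray that starts inside the open square and is outside at time \<open>s\<close> has met its frontier.\<close>
  have exit: "\<exists>t\<in>?H. t \<le> s \<and> ?ray t \<in> frontier (box (0, 0) (1, 1))"
    if "?ray s \<notin> box (0, 0) (1, 1)" "\<epsilon> \<le> s" for s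
  proof -
    have "connected (?ray ` {\<epsilon> / 2..s})"
      by (intro connected_continuous_image) (auto intro!: continuous_intros)
    moreover have "?ray (\<epsilon> / 2) \<in> ?ray ` {\<epsilon> / 2..s} \<inter> box (0, 0) (1, 1)"
      using \<epsilon>[of "\<epsilon> / 2"] \<open>\<epsilon> > 0\<close> that(2) by auto
    moreover have "?ray s \<in> ?ray ` {\<epsilon> / 2..s} - box (0, 0) (1, 1)"
      using that \<open>\<epsilon> > 0\<close> by auto
    ultimately have "?ray ` {\<epsilon> / 2..s} \<inter> frontier (box (0, 0) (1, 1)) \<noteq> {}"
      using connected_Int_frontier[of "?ray ` {\<epsilon> / 2..s}" "box (0, 0) (1, 1)"] by fast
    then obtain t where t: "t \<in> {\<epsilon> / 2..s}" "?ray t \<in> frontier (box (0, 0) (1, 1))"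
      by blast
    then have "t \<in> ?H"
      using frontier_unit_square_subset[of a n] \<open>\<epsilon> > 0\<close> by (auto simp: hitting_times_def z)
    with t show ?thesis by auto
  qed
  have "?H \<noteq> {}"
  proof -
    \<comment> \<open>By this time the horizontal displacement exceeds the width of the square.\<close>
    define s where "s = \<epsilon> + 2 / \<bar>fst v\<bar>"
    have "s * \<bar>fst v\<bar> \<ge> 2"
      using assms(2) \<open>\<epsilon> > 0\<close> by (simp add: s_def z distrib_right)
    moreover have "s > 0"
      using \<open>\<epsilon> > 0\<close> by (simp add: s_def add_pos_nonneg)
    ultimately have "\<bar>s * fst v\<bar> \<ge> 2"
      by (simp add: abs_mult)
    moreover have "0 \<le> fst x" "fst x \<le> 1"
      using assms(1) by (auto simp: inward_def z cbox_Pair_eq)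
    ultimately have "?ray s \<notin> box (0, 0) (1, 1)"
      by (cases x; cases v) (auto simp: box_Pair_eq)
    then show ?thesis
      using exit[of s] by (auto simp: s_def)
  qed
  then have "?T \<in> ?H"
    using \<open>closed ?H\<close> bdd by (simp add: closed_contains_Inf)
  have min: "?T \<le> t" if "t \<in> ?H" for t
    using that bdd by (simp add: cInf_lower)
  have "?ray ?T \<in> cbox (0, 0) (1, 1)"
  proof (cases "?ray ?T \<in> box (0, 0) (1, 1)")
    case True
    then show ?thesis using box_subset_cbox by blast
  next
    case False
    then obtain t where "t \<in> ?H" "t \<le> ?T" "?ray t \<in> frontier (box (0, 0) (1, 1))"
      using exit[OF False H_ge[OF \<open>?T \<in> ?H\<close>]] by auto
    moreover have "t = ?T"
      using min[OF \<open>t \<in> ?H\<close>] \<open>t \<le> ?T\<close> by simp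
    ultimately show ?thesis
      unfolding frontier_unit_square by blast
  qed
  then have "next_collision a n z \<in> cbox (0, 0) (1, 1)"
    by (simp add: next_collision_hitting_times z)
  moreover have "?T > 0"
    using \<open>?T \<in> ?H\<close> by (simp add: hitting_times_def)
  ultimately show thesis
    using that \<open>?T \<in> ?H\<close> min by blast
qed

lemma reflect_reflect: "reflect a n y (reflect a n y v) = v"
  by (auto simp: reflect_def)

text \<open>The collision point and the reflected direction determine the direction of arrival, since
  reflection at a fixed point is an involution. Both basepoints then lie on the backward ray from the
  collision point; if they were different, the trajectory from the farther one would already have
  collided at the nearer one.\<close>
lemma billiard_map_inj:
  assumes "inward a n z" "fst (snd z) \<noteq> 0" "inward a n z'" "fst (snd z') \<noteq> 0"
    and "billiard_map a n z = Some y" "billiard_map a n z' = Some y"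
  shows "z = z'"
proof -
  have y: "fst y = next_collision a n z" "fst y = next_collision a n z'"
    "snd y = reflect a n (fst y) (snd z)" "snd y = reflect a n (fst y) (snd z')"
    using assms(5,6) by (auto simp: billiard_map_def Let_def split: if_splits)
  then have v: "snd z = snd z'"
    by (metis reflect_reflect)
  obtain T where T: "T > 0" "next_collision a n z = fst z + T *\<^sub>R snd z"
    "\<And>t. t \<in> hitting_times a n z \<Longrightarrow> T \<le> t"
    using inward_first_hit[OF assms(1,2)] next_collision_hitting_times by metis
  obtain T' where T': "T' > 0" "next_collision a n z' = fst z' + T' *\<^sub>R snd z'"
    "\<And>t. t \<in> hitting_times a n z' \<Longrightarrow> T' \<le> t"
    using inward_first_hit[OF assms(3,4)] next_collision_hitting_times by metis
  have eq: "fst z + T *\<^sub>R snd z = fst z' + T' *\<^sub>R snd z"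
    using y T(2) T'(2) v by simp
  have bd: "fst z \<in> table_boundary a n" "fst z' \<in> table_boundary a n"
    using assms(1,3) by (auto simp: inward_def)
  have "fst z' + (T' - T) *\<^sub>R snd z' = fst z" "fst z + (T - T') *\<^sub>R snd z = fst z'"
    using eq v by (auto simp: algebra_simps)
  then have "T < T' \<Longrightarrow> T' - T \<in> hitting_times a n z'" "T' < T \<Longrightarrow> T - T' \<in> hitting_times a n z"
    using bd by (simp_all only: hitting_times_def mem_Collect_eq diff_gt_0_iff_gt)
  then have "T = T'"
    using T(1) T(3)[of "T - T'"] T'(1) T'(3)[of "T' - T"] by linarith
  then show ?thesis
    using eq v by (simp add: prod_eq_iff)
qed


section \<open>Lines through no lattice point\<close>

text \<open>The trajectory line of the phase has an equation \<open>2 * h * (u * y - w * x) = N\<close> with \<open>N\<close> odd,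
  and its direction is proportional to \<open>(u, w) = (\<plusminus> Q, \<plusminus> P)\<close>, so that \<open>\<bar>slope\<bar> = P / Q\<close>. The grid
  spacing is \<open>1 / h\<close>. The factor \<open>\<kappa>\<close> is carried along to keep the speed fixed.\<close>
definition odd_line :: "nat \<Rightarrow> real \<Rightarrow> nat \<Rightarrow> nat \<Rightarrow> phase \<Rightarrow> bool" where
  "odd_line h \<kappa> P Q z \<longleftrightarrow>
     (\<exists>u w N :: int. \<bar>u\<bar> = int Q \<and> \<bar>w\<bar> = int P \<and> odd N \<and> snd z = (\<kappa> * u, \<kappa> * w) \<and>
        2 * real h * (u * snd (fst z) - w * fst (fst z)) = N)"

text \<open>At a point with both coordinates in \<open>\<int> / h\<close> the left-hand side of the equation is even.\<close>
lemma odd_line_avoids_grid_points: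
  assumes "odd_line h \<kappa> P Q (x, v)" "h * fst x \<in> \<int>" "h * snd x \<in> \<int>"
  shows False
proof -
  obtain u w N :: int where "odd N" and N: "2 * real h * (u * snd x - w * fst x) = N"
    using assms(1) by (auto simp: odd_line_def)
  obtain i j where ij: "h * fst x = of_int i" "h * snd x = of_int j"
    using assms(2,3) by (auto elim!: Ints_cases)
  have "real_of_int N = 2 * (u * (h * snd x) - w * (h * fst x))"
    using N by (simp add: algebra_simps)
  also have "\<dots> = of_int (2 * (u * j - w * i))"
    by (simp add: ij)
  finally have "N = 2 * (u * j - w * i)"
    by (simp only: of_int_eq_iff)
  with \<open>odd N\<close> show False by simp
qed

text \<open>The left-hand side of the equation is the cross product of direction and position.\<close>
lemma odd_line_flight:
  assumes "odd_line h \<kappa> P Q (x, v)"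
  shows "odd_line h \<kappa> P Q (x + t *\<^sub>R v, v)"
  using assms unfolding odd_line_def by (fastforce simp: algebra_simps)

text \<open>Changing \<open>u\<close> to \<open>- u\<close> turns \<open>N\<close> into \<open>- N - 4 * w * (h * x)\<close>, and \<open>h * x\<close> is an integer on a vertical
  wall.\<close>
lemma odd_line_reflect_vertical:
  assumes "odd_line h \<kappa> P Q (x, v)" "h * fst x \<in> \<int>"
  shows "odd_line h \<kappa> P Q (x, (- fst v, snd v))"
proof -
  obtain u w N :: int where uw: "\<bar>u\<bar> = int Q" "\<bar>w\<bar> = int P" "odd N" "v = (\<kappa> * u, \<kappa> * w)"
    and N: "2 * real h * (u * snd x - w * fst x) = N"
    using assms(1) by (auto simp: odd_line_def)
  obtain i where i: "h * fst x = of_int i"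
    using assms(2) by (auto elim: Ints_cases)
  have "2 * real h * ((- u) * snd x - w * fst x) =
      - (2 * real h * (u * snd x - w * fst x)) - 4 * w * (h * fst x)"
    by (simp add: algebra_simps)
  then have "2 * real h * ((- u) * snd x - w * fst x) = of_int (- N - 4 * w * i)"
    unfolding N i by simp
  then show ?thesis
    using uw unfolding odd_line_def
    by (intro exI[of _ "- u"] exI[of _ w] exI[of _ "- N - 4 * w * i"]) auto
qed

lemma odd_line_reflect_horizontal:
  assumes "odd_line h \<kappa> P Q (x, v)" "h * snd x \<in> \<int>"
  shows "odd_line h \<kappa> P Q (x, (fst v, - snd v))"
proof -
  obtain u w N :: int where uw: "\<bar>u\<bar> = int Q" "\<bar>w\<bar> = int P" "odd N" "v = (\<kappa> * u, \<kappa> * w)"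
    and N: "2 * real h * (u * snd x - w * fst x) = N"
    using assms(1) by (auto simp: odd_line_def)
  obtain i where i: "h * snd x = of_int i"
    using assms(2) by (auto elim: Ints_cases)
  have "2 * real h * (u * snd x - (- w) * fst x) =
      4 * u * (h * snd x) - (2 * real h * (u * snd x - w * fst x))"
    by (simp add: algebra_simps)
  then have "2 * real h * (u * snd x - (- w) * fst x) = of_int (4 * u * i - N)"
    unfolding N i by simp
  then show ?thesis
    using uw unfolding odd_line_def
    by (intro exI[of _ u] exI[of _ "- w"] exI[of _ "4 * u * i - N"]) auto
qed



section \<open>Collisions and the parity invariant\<close>

lemma eventually_off_grid:
  fixes r d :: real
  assumes "d \<noteq> 0" "h > 0"
  shows "\<forall>\<^sub>F t in at_right 0. h * (r + t * d) \<notin> \<int>"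
proof -
  have "\<not> h * r islimpt \<int>"
    by (rule discrete_imp_not_islimpt[of 1]) (auto simp: dist_real_def elim!: Ints_cases)
  then have "\<forall>\<^sub>F s in at (h * r). s \<notin> \<int>"
    by (simp add: islimpt_iff_eventually)
  moreover have "filterlim (\<lambda>t. h * (r + t * d)) (at (h * r)) (at_right 0)"
    unfolding filterlim_at using assms
    by (auto intro!: tendsto_eq_intros simp: eventually_at_filter)
  ultimately show ?thesis
    by (rule eventually_compose_filterlim)
qed

lemma eventually_in_unit_interval:
  fixes r d :: real
  assumes "0 \<le> r" "r \<le> 1" "r = 0 \<Longrightarrow> d > 0" "r = 1 \<Longrightarrow> d < 0"
  shows "\<forall>\<^sub>F t in at_right 0. 0 < r + t * d \<and> r + t * d < 1"
proof -
  have lim: "((\<lambda>t. r + t * d) \<longlongrightarrow> r) (at_right 0)"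
    by (auto intro!: tendsto_eq_intros)
  have pos: "\<forall>\<^sub>F t in at_right 0. (0::real) < t"
    by (rule eventually_at_right_less)
  have "\<forall>\<^sub>F t in at_right 0. 0 < r + t * d"
  proof (cases "r = 0")
    case True
    with assms(3) show ?thesis
      using pos by (auto elim: eventually_mono)
  next
    case False
    with assms(1) show ?thesis
      using order_tendstoD(1)[OF lim, of 0] by simp
  qed
  moreover have "\<forall>\<^sub>F t in at_right 0. r + t * d < 1"
  proof (cases "r = 1")
    case True
    with assms(4) show ?thesis
      using pos by (auto elim!: eventually_mono simp: mult_pos_neg)
  next
    case False
    with assms(2) show ?thesis
      using order_tendstoD(2)[OF lim, of 1] by simp
  qed
  ultimately show ?thesis
    by (rule eventually_conj)
qed

text \<open>Since the boundary is contained in the grid lines, a ray that is parallel to neither axis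
  leaves it at once, even from a corner. Only the sides of the unit square restrict the
  direction.\<close>
lemma inward_oblique:
  assumes "a \<ge> 3" "y \<in> table_boundary a n" "y \<in> cbox (0, 0) (1, 1)"
    and "fst w \<noteq> 0" "fst y = 0 \<Longrightarrow> fst w > 0" "fst y = 1 \<Longrightarrow> fst w < 0"
    and "snd w \<noteq> 0" "snd y = 0 \<Longrightarrow> snd w > 0" "snd y = 1 \<Longrightarrow> snd w < 0"
  shows "inward a n (y, w)"
proof -
  have y: "0 \<le> fst y" "fst y \<le> 1" "0 \<le> snd y" "snd y \<le> 1"
    using assms(3) by (auto simp: cbox_Pair_eq)
  have "real (a ^ n) > 0"
    using assms(1) by simp
  then have "\<forall>\<^sub>F t in at_right 0.
      (a ^ n * (fst y + t * fst w) \<notin> \<int> \<and> a ^ n * (snd y + t * snd w) \<notin> \<int>) \<and>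
      (0 < fst y + t * fst w \<and> fst y + t * fst w < 1) \<and>
      (0 < snd y + t * snd w \<and> snd y + t * snd w < 1)"
    using assms y by (intro eventually_conj eventually_off_grid eventually_in_unit_interval) auto
  then have "\<forall>\<^sub>F t in at_right 0. y + t *\<^sub>R w \<in> box (0, 0) (1, 1) - table_boundary a n"
  proof (rule eventually_mono)
    fix t
    assume t: "(a ^ n * (fst y + t * fst w) \<notin> \<int> \<and> a ^ n * (snd y + t * snd w) \<notin> \<int>) \<and>
      (0 < fst y + t * fst w \<and> fst y + t * fst w < 1) \<and>
      (0 < snd y + t * snd w \<and> snd y + t * snd w < 1)"
    then have "y + t *\<^sub>R w \<notin> table_boundary a n"
      using vertical_sides_on_grid[OF assms(1), of "y + t *\<^sub>R w" n]
        horizontal_sides_on_grid[OF assms(1), of "y + t *\<^sub>R w" n]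
      unfolding table_boundary_sides[OF assms(1)] by auto
    with t show "y + t *\<^sub>R w \<in> box (0, 0) (1, 1) - table_boundary a n"
      by (simp add: box_Pair_eq mem_Times_iff)
  qed
  then show ?thesis
    using assms by (simp add: inward_def)
qed

text \<open>If the collision point lies on a side of the unit square, then the trajectory came from inside,
  so that side is approached by the component of the velocity which the reflection reverses.\<close>
lemma inward_reflect:
  assumes "a \<ge> 3" "inward a n (x, v)" "fst v \<noteq> 0" "snd v \<noteq> 0"
  defines "y \<equiv> next_collision a n (x, v)"
  shows "inward a n (y, reflect a n y v)"
proof -
  obtain T where "T > 0" "Inf (hitting_times a n (x, v)) = T" "T \<in> hitting_times a n (x, v)"
    and y: "y \<in> cbox (0, 0) (1, 1)"
    using inward_first_hit[OF assms(2)] assms(3) unfolding y_def by auto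
  then have T: "y = x + T *\<^sub>R v" "y \<in> table_boundary a n"
    by (auto simp: y_def next_collision_hitting_times hitting_times_def)
  have x: "0 \<le> fst x" "fst x \<le> 1" "0 \<le> snd x" "snd x \<le> 1"
    using assms(2) by (auto simp: inward_def cbox_Pair_eq)
  have y': "0 \<le> fst y" "fst y \<le> 1" "0 \<le> snd y" "snd y \<le> 1"
    using y by (auto simp: cbox_Pair_eq)
  have square: "((0, 0), (1, 1)) \<in> walls a n"
    by (simp add: walls_def)
  have vert: "y \<in> (\<Union>s\<in>walls a n. vertical_sides s)" if "fst y = 0 \<or> fst y = 1"
    using square that y' by (intro UN_I[OF square]) (cases y; auto)
  have hor: "y \<in> (\<Union>s\<in>walls a n. horizontal_sides s)" if "snd y = 0 \<or> snd y = 1"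
    using square that y' by (intro UN_I[OF square]) (cases y; auto)
  have "fst v < 0" if "fst y = 0"
    using that x(1) T(1) \<open>T > 0\<close> assms(3)
    by (smt (verit) fst_add fst_scaleR mult_pos_pos real_scaleR_def)
  moreover have "fst v > 0" if "fst y = 1"
    using that x(2) T(1) \<open>T > 0\<close> assms(3)
    by (smt (verit) fst_add fst_scaleR mult_pos_neg real_scaleR_def)
  moreover have "snd v < 0" if "snd y = 0"
    using that x(3) T(1) \<open>T > 0\<close> assms(4)
    by (smt (verit) snd_add snd_scaleR mult_pos_pos real_scaleR_def)
  moreover have "snd v > 0" if "snd y = 1"
    using that x(4) T(1) \<open>T > 0\<close> assms(4)
    by (smt (verit) snd_add snd_scaleR mult_pos_neg real_scaleR_def)
  moreover have "fst (reflect a n y v) = (if y \<in> (\<Union>s\<in>walls a n. vertical_sides s) then - fst v else fst v)"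
    "snd (reflect a n y v) = (if y \<in> (\<Union>s\<in>walls a n. horizontal_sides s) then - snd v else snd v)"
    by (simp_all add: reflect_def)
  ultimately show ?thesis
    using assms(1,3,4) T(2) y vert hor by (intro inward_oblique) (auto split: if_splits)
qed

text \<open>The invariant at work. A collision point is on at least one grid line, being on the boundary,
  and not on two, by parity. So the orbit meets no corner, and exactly one component of the direction
  is reversed.\<close>
lemma odd_line_billiard_map:
  assumes "a \<ge> 3" "\<kappa> \<noteq> 0" "P > 0" "Q > 0" and "inward a n z" "odd_line (a ^ n) \<kappa> P Q z"
  obtains z' where "billiard_map a n z = Some z'" "inward a n z'" "odd_line (a ^ n) \<kappa> P Q z'"
proof -
  obtain x v where z: "z = (x, v)" by (cases z)
  have v: "fst v \<noteq> 0" "snd v \<noteq> 0"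
    using assms(2-4,6) by (auto simp: odd_line_def z)
  define y where "y = next_collision a n (x, v)"
  have inw: "inward a n (y, reflect a n y v)"
    using inward_reflect[of a n x v] assms(1,5) v by (simp add: z y_def)
  have line: "odd_line (a ^ n) \<kappa> P Q (y, v)"
    using odd_line_flight assms(6) by (simp add: y_def next_collision_hitting_times z)
  have not_both: "\<not> (y \<in> (\<Union>s\<in>walls a n. vertical_sides s) \<and>
      y \<in> (\<Union>s\<in>walls a n. horizontal_sides s))"
    using odd_line_avoids_grid_points[OF line] vertical_sides_on_grid[OF assms(1)]
      horizontal_sides_on_grid[OF assms(1)] by blast
  then have "y \<notin> peripheral_corners a n"
    by (auto simp: peripheral_corners_def walls_def)
  then have "billiard_map a n z = Some (y, reflect a n y v)"
    by (simp add: billiard_map_def z y_def Let_def)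
  moreover have "odd_line (a ^ n) \<kappa> P Q (y, reflect a n y v)"
  proof (cases "y \<in> (\<Union>s\<in>walls a n. vertical_sides s)")
    case True
    then have "reflect a n y v = (- fst v, snd v)"
      using not_both by (simp only: reflect_def) simp
    then show ?thesis
      using odd_line_reflect_vertical[OF line vertical_sides_on_grid[OF assms(1) True]] by simp
  next
    case False
    then have hor: "y \<in> (\<Union>s\<in>walls a n. horizontal_sides s)"
      using inw unfolding inward_def table_boundary_sides[OF assms(1)] by blast
    have "reflect a n y v = (fst v, - snd v)"
      using False hor by (simp only: reflect_def) simp
    then show ?thesis
      using odd_line_reflect_horizontal[OF line horizontal_sides_on_grid[OF assms(1) hor]] by simp
  qed
  ultimately show thesis
    using that inw by blast
qed


section \<open>Periodicity\<close>

text \<open>One coordinate of the basepoint is in \<open>\<int> / h\<close>, and the equation of the line puts the other one in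
  \<open>\<int> / (2 * h * P)\<close> or \<open>\<int> / (2 * h * Q)\<close>. So \<open>2 * h * P * Q\<close> is a common denominator for all basepoints,
  which lie in the unit square.\<close>
lemma finite_odd_line_phases:
  assumes "a \<ge> 3" "P > 0" "Q > 0"
  shows "finite {z. inward a n z \<and> odd_line (a ^ n) \<kappa> P Q z}" (is "finite ?F")
proof -
  define M where "M = 2 * real (a ^ n) * P * Q"
  have "M > 0"
    using assms by (simp add: M_def)
  let ?I = "(\<lambda>(i, j). (of_int i / M, of_int j / M)) ` ({0..\<lfloor>M\<rfloor>} \<times> {0..\<lfloor>M\<rfloor>})"
  let ?V = "(\<lambda>(u, w). (\<kappa> * of_int u, \<kappa> * of_int w)) ` ({- int Q..int Q} \<times> {- int P..int P})"
  have "z \<in> ?I \<times> ?V" if z: "z \<in> ?F" for z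
  proof -
    obtain x v where xv: "z = (x, v)" by (cases z)
    obtain u w N :: int where uw: "\<bar>u\<bar> = int Q" "\<bar>w\<bar> = int P" "v = (\<kappa> * u, \<kappa> * w)"
      and N: "2 * real (a ^ n) * (u * snd x - w * fst x) = N"
      using z by (auto simp: odd_line_def xv)
    have x: "0 \<le> fst x" "fst x \<le> 1" "0 \<le> snd x" "snd x \<le> 1"
      using z by (auto simp: inward_def xv cbox_Pair_eq)
    \<comment> \<open>With these equations, solving for a coordinate needs no division by \<open>u\<close> or \<open>w\<close>.\<close>
    have QP: "real Q = of_int (sgn u) * of_int u" "real P = of_int (sgn w) * of_int w"
      using uw(1,2) by (metis abs_sgn mult.commute of_int_mult of_int_of_nat_eq)+
    have "a ^ n * fst x \<in> \<int> \<or> a ^ n * snd x \<in> \<int>"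
      using z vertical_sides_on_grid[OF assms(1)] horizontal_sides_on_grid[OF assms(1)]
      unfolding xv inward_def table_boundary_sides[OF assms(1)] by blast
    then have "M * fst x \<in> \<int> \<and> M * snd x \<in> \<int>"
    proof
      assume "a ^ n * fst x \<in> \<int>"
      then obtain m where m: "a ^ n * fst x = of_int m"
        by (auto elim: Ints_cases)
      have "M * fst x = 2 * P * Q * (a ^ n * fst x)"
        by (simp add: M_def)
      then have "M * fst x = of_int (2 * int P * int Q * m)"
        unfolding m by simp
      moreover have "M * snd x = P * sgn u * (N + 2 * w * (a ^ n * fst x))"
        unfolding N[symmetric] M_def QP(1) by (simp add: algebra_simps)
      then have "M * snd x = of_int (int P * sgn u * (N + 2 * w * m))"
        unfolding m by simp
      ultimately show ?thesis
        by (metis Ints_of_int)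
    next
      assume "a ^ n * snd x \<in> \<int>"
      then obtain m where m: "a ^ n * snd x = of_int m"
        by (auto elim: Ints_cases)
      have "M * snd x = 2 * P * Q * (a ^ n * snd x)"
        by (simp add: M_def)
      then have "M * snd x = of_int (2 * int P * int Q * m)"
        unfolding m by simp
      moreover have "M * fst x = Q * sgn w * (2 * u * (a ^ n * snd x) - N)"
        unfolding N[symmetric] M_def QP(2) by (simp add: algebra_simps)
      then have "M * fst x = of_int (int Q * sgn w * (2 * u * m - N))"
        unfolding m by simp
      ultimately show ?thesis
        by (metis Ints_of_int)
    qed
    then obtain i j where ij: "M * fst x = of_int i" "M * snd x = of_int j"
      by (auto elim!: Ints_cases)
    have "0 \<le> M * fst x" "M * fst x \<le> M" "0 \<le> M * snd x" "M * snd x \<le> M"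
      using x \<open>M > 0\<close> by (auto simp: mult_left_le)
    then have "(i, j) \<in> {0..\<lfloor>M\<rfloor>} \<times> {0..\<lfloor>M\<rfloor>}"
      by (simp add: ij le_floor_iff)
    moreover have "x = (of_int i / M, of_int j / M)"
      using \<open>M > 0\<close> by (simp add: prod_eq_iff field_simps flip: ij)
    ultimately have "x \<in> ?I"
      by force
    moreover have "(u, w) \<in> {- int Q..int Q} \<times> {- int P..int P}"
      using uw(1,2) by auto
    then have "v \<in> ?V"
      using uw(3) by force
    ultimately show ?thesis
      by (simp add: xv)
  qed
  then have "?F \<subseteq> ?I \<times> ?V" by blast
  then show ?thesis
    by (rule finite_subset) auto
qed

lemma periodic_orbit_finite_inj:
  assumes "finite F" "z \<in> F"
    and step: "\<And>y. y \<in> F \<Longrightarrow> \<exists>y'\<in>F. billiard_map a n y = Some y'"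
    and inj: "\<And>y y' w. y \<in> F \<Longrightarrow> y' \<in> F \<Longrightarrow> billiard_map a n y = Some w \<Longrightarrow>
      billiard_map a n y' = Some w \<Longrightarrow> y = y'"
  shows "periodic_orbit (orbit a n z)"
proof -
  have "\<exists>y\<in>F. orbit a n z i = Some y" for i
  proof (induction i)
    case 0
    show ?case using assms(2) by simp
  next
    case (Suc i)
    then show ?case using step by auto
  qed
  then obtain s where s: "\<And>i. s i \<in> F" "\<And>i. orbit a n z i = Some (s i)"
    by metis
  have s_step: "billiard_map a n (s i) = Some (s (Suc i))" for i
    using s(2)[of "Suc i"] s(2)[of i] by simp
  \<comment> \<open>By injectivity a repetition can be moved back to the start.\<close>
  have shift: "s 0 = s d" if "s i = s (i + d)" for i d
    using that
  proof (induction i)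
    case (Suc i)
    then show ?case
      using inj[OF s(1) s(1), of i "s (Suc i)" "i + d"] s_step[of i] s_step[of "i + d"] by simp
  qed simp
  have "\<not> inj s"
    using assms(1) s(1) by (metis finite_imageD finite_subset image_subsetI infinite_UNIV_nat)
  then obtain i j where "i < j" "s i = s j"
    by (metis injI linorder_neqE_nat)
  then have "s 0 = s (j - i)"
    by (intro shift[of i]) simp
  then show ?thesis
    unfolding periodic_orbit_def using s(2) \<open>i < j\<close>
    by (metis One_nat_def Suc_leI option.distinct(1) zero_less_diff)
qed

theorem odd_line_periodic:
  assumes "a \<ge> 3" "\<kappa> \<noteq> 0" "P > 0" "Q > 0" and "inward a n z" "odd_line (a ^ n) \<kappa> P Q z"
  shows "periodic_orbit (orbit a n z)"
proof (rule periodic_orbit_finite_inj)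
  let ?F = "{z. inward a n z \<and> odd_line (a ^ n) \<kappa> P Q z}"
  show "finite ?F"
    using assms by (simp add: finite_odd_line_phases)
  show "z \<in> ?F"
    using assms by simp
  show "\<exists>y'\<in>?F. billiard_map a n y = Some y'" if "y \<in> ?F" for y
    using that odd_line_billiard_map[OF assms(1-4), of n y] by blast
  have "fst (snd y) \<noteq> 0" if "y \<in> ?F" for y
    using that assms(2,4) by (auto simp: odd_line_def)
  then show "y = y'" if "y \<in> ?F" "y' \<in> ?F" "billiard_map a n y = Some w"
      "billiard_map a n y' = Some w" for y y' w
    using that billiard_map_inj by blast
qed


section \<open>Starting on the bottom side\<close>

lemma initial_condition_inward:
  assumes "initial_condition a n (x, v)"
  shows "\<forall>\<^sub>F t in at_right 0. x + t *\<^sub>R v \<in> box (0, 0) (1, 1)"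
proof -
  have "\<forall>\<^sub>F t in at_right 0. x + t *\<^sub>R v \<in> prefractal a n - table_boundary a n"
    using assms by (auto simp: initial_condition_def eventually_at_right_field)
  then show ?thesis
    by (rule eventually_mono)
      (use unit_square_diff_boundary[of a n] in \<open>auto simp: prefractal_obstacles\<close>)
qed

text \<open>All obstacles are at height at least \<open>1 / a ^ n\<close>, so near the bottom side the table looks like the
  unit square.\<close>
lemma bottom_phase:
  assumes "a \<ge> 3" "0 < r" "r < 1" "norm v = 1" "fst v \<noteq> 0" "snd v > 0"
  shows "inward a n ((r, 0), v)" "initial_condition a n ((r, 0), v)"
proof -
  have "(r, 0) \<in> (\<Union>s\<in>walls a n. horizontal_sides s)"
    using assms(2,3) by (intro UN_I[of "((0, 0), (1, 1))"]) (auto simp: walls_def)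
  then have bd: "(r, 0) \<in> table_boundary a n"
    by (simp add: table_boundary_sides[OF assms(1)])
  then show inw: "inward a n ((r, 0), v)"
    using assms by (intro inward_oblique) auto
  define h where "h = real (a ^ n)"
  have "h > 0"
    using assms(1) by (simp add: h_def)
  have "((\<lambda>t. t * snd v) \<longlongrightarrow> 0) (at_right 0)"
    by (auto intro!: tendsto_eq_intros)
  then have "\<forall>\<^sub>F t in at_right 0. t * snd v < 1 / h"
    by (rule order_tendstoD(2)) (use \<open>h > 0\<close> in simp)
  moreover have "\<forall>\<^sub>F t in at_right 0. (r, 0) + t *\<^sub>R v \<in> box (0, 0) (1, 1) - table_boundary a n"
    using inw by (simp add: inward_def)
  ultimately have "\<forall>\<^sub>F t in at_right 0. (r, 0) + t *\<^sub>R v \<in> prefractal a n - table_boundary a n"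
  proof eventually_elim
    fix t
    assume t: "t * snd v < 1 / h" "(r, 0) + t *\<^sub>R v \<in> box (0, 0) (1, 1) - table_boundary a n"
    have "(r, 0) + t *\<^sub>R v \<notin> box l u" if lu: "(l, u) \<in> obstacles a n" for l u
    proof -
      obtain i j i' j' where c: "l = grid_point a n i j" "u = grid_point a n i' j'" "0 < j"
        using obstacle_corners[OF assms(1) lu] by metis
      have "1 / h \<le> real j / h"
        using \<open>h > 0\<close> c(3) by (intro divide_right_mono) auto
      with t(1) c show ?thesis
        by (auto simp: grid_point_def h_def box_Pair_eq mem_Times_iff)
    qed
    with t(2) show "(r, 0) + t *\<^sub>R v \<in> prefractal a n - table_boundary a n"
      using box_subset_cbox[of "(0, 0)::point" "(1, 1)"] unfolding prefractal_obstacles by blast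
  qed
  then show "initial_condition a n ((r, 0), v)"
    using bd assms(4) by (auto simp: initial_condition_def eventually_at_right_field)
qed

lemma compatible_self:
  assumes "initial_condition a n z" "initial_condition a m z"
  shows "compatible a n m z z"
proof -
  obtain x v where z: "z = (x, v)" by (cases z)
  obtain \<epsilon> where \<epsilon>: "\<epsilon> > 0" "\<And>t. 0 < t \<Longrightarrow> t < \<epsilon> \<Longrightarrow> x + t *\<^sub>R v \<notin> table_boundary a n"
    and x: "x \<in> table_boundary a n"
    using assms(1) by (auto simp: initial_condition_def z)
  have "y = x" if y_in: "y \<in> closed_segment x (x + (\<epsilon> / 2) *\<^sub>R v)" "y \<in> table_boundary a n" for y
  proof -
    obtain t where t: "0 \<le> t" "t \<le> 1" "y = (1 - t) *\<^sub>R x + t *\<^sub>R (x + (\<epsilon> / 2) *\<^sub>R v)"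
      using y_in(1) unfolding in_segment by blast
    have y: "y = x + (t * (\<epsilon> / 2)) *\<^sub>R v"
      unfolding t(3) by (simp add: scaleR_add_right scaleR_diff_left)
    have "t * (\<epsilon> / 2) < \<epsilon>"
      using t \<epsilon>(1) by (smt (verit) field_sum_of_halves mult_left_le_one_le)
    then have "\<not> 0 < t * (\<epsilon> / 2)"
      using \<epsilon>(2) y_in(2) y by blast
    then have "t = 0"
      using t(1) \<epsilon>(1) by (simp add: zero_less_mult_iff)
    then show ?thesis by (simp add: y)
  qed
  then have "closed_segment x (x + (\<epsilon> / 2) *\<^sub>R v) \<inter> table_boundary a n = {x}"
    using x by auto
  moreover have "{x, x} \<subseteq> closed_segment x (x + (\<epsilon> / 2) *\<^sub>R v)"
    by simp
  moreover have "0 < \<epsilon> / 2"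
    using \<epsilon>(1) by simp
  ultimately have "\<exists>c s. 0 < s \<and> {x, x} \<subseteq> closed_segment c (c + s *\<^sub>R v) \<and>
      closed_segment c (c + s *\<^sub>R v) \<inter> table_boundary a n = {x}"
    by blast
  then show ?thesis
    using assms unfolding compatible_def z by simp
qed

text \<open>The segment required by compatibility contains the basepoint of \<open>z\<close>, and its only point on the
  finer boundary is the basepoint of \<open>z'\<close>.\<close>
lemma compatible_unique:
  assumes "compatible a n m z' z" "fst z \<in> table_boundary a n"
  shows "z' = z"
proof -
  obtain S where "fst z \<in> S" "S \<inter> table_boundary a n = {fst z'}" and v: "snd z' = snd z"
    using assms(1) unfolding compatible_def by blast
  then have "fst z' = fst z"
    using assms(2) by (metis IntI singletonD)
  with v show ?thesis by (simp add: prod_eq_iff)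
qed

theorem theorem4p34:
  fixes a k p :: nat and \<alpha> \<theta> :: real and z :: phase
  assumes "a \<ge> 3" and "odd a"
    and "\<alpha> \<in> slopes a"
    and "0 < p" and "odd p" and "p \<le> a ^ k"
    and "tan \<theta> = \<alpha>"
    and "z = ((real p / (2 * real (a ^ k)), 0), (cos \<theta>, sin \<theta>))"
    and "initial_condition a k z"
  shows "\<exists>orb. orb k = orbit a k z \<and> compatible_periodic_orbits a k orb \<and>
           (\<forall>orb'. orb' k = orbit a k z \<and> compatible_orbits a k orb' \<longrightarrow>
              (\<forall>n\<ge>k. orb' n = orb n))"
proof -
  obtain P Q :: nat where PQ: "\<alpha> = real P / real Q" "odd P" "odd Q"
    using assms(3) by (auto simp: slopes_def)
  then have PQ_pos: "P > 0" "Q > 0"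
    by (auto simp: odd_pos)
  define r where "r = real p / (2 * real (a ^ k))"
  define v where "v = (cos \<theta>, sin \<theta>)"
  have z: "z = ((r, 0), v)"
    using assms(8) by (simp add: r_def v_def)
  have "real p \<le> real (a ^ k)"
    using assms(6) by (simp only: of_nat_le_iff)
  then have "real p < 2 * real (a ^ k)"
    using assms(4) by linarith
  then have r: "0 < r" "r < 1"
    using assms(1,4) by (simp_all add: r_def)
  have "cos \<theta> \<noteq> 0"
    using assms(7) PQ(1) PQ_pos by (auto simp: tan_def)
  then have sin: "sin \<theta> = P / Q * cos \<theta>"
    using assms(7) PQ(1) by (auto simp: tan_def field_simps)
  have "\<forall>\<^sub>F t in at_right 0. (0 < t) \<and> (r, 0) + t *\<^sub>R v \<in> box (0, 0) (1, 1)"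
    by (rule eventually_conj[OF eventually_at_right_less
          initial_condition_inward[OF assms(9)[unfolded z]]])
  then obtain t where "0 < t" "(r, 0) + t *\<^sub>R v \<in> box (0, 0) (1, 1)"
    using eventually_happens trivial_limit_at_right_real by blast
  then have "sin \<theta> > 0"
    by (auto simp: v_def box_Pair_eq zero_less_mult_iff)
  then have init: "initial_condition a n z" and inw: "inward a n z" for n
    using bottom_phase[OF assms(1) r, of v n] \<open>cos \<theta> \<noteq> 0\<close> by (auto simp: z v_def norm_Pair)
  \<comment> \<open>The factor with \<open>v = \<kappa> * (Q, P)\<close>.\<close>
  define \<kappa> where "\<kappa> = cos \<theta> / Q"
  have "\<kappa> \<noteq> 0"
    using \<open>cos \<theta> \<noteq> 0\<close> PQ_pos by (simp add: \<kappa>_def)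
  have line: "odd_line (a ^ n) \<kappa> P Q z" if "n \<ge> k" for n
  proof -
    \<comment> \<open>In units of half a cell the starting point is at \<open>p * a ^ (n - k)\<close>, which is odd as \<open>a\<close> and \<open>p\<close> are.\<close>
    have "2 * real (a ^ n) * r = p * a ^ (n - k)"
      using assms(1) that by (simp add: r_def field_simps flip: power_add)
    then have "2 * real (a ^ n) * (Q * 0 - P * r) = of_int (- int (P * p * a ^ (n - k)))"
      by simp
    moreover have "odd (P * p * a ^ (n - k))"
      using PQ(2) assms(2,5) by simp
    moreover have "v = (\<kappa> * Q, \<kappa> * P)"
      using PQ_pos by (simp add: v_def \<kappa>_def sin)
    ultimately show ?thesis
      unfolding odd_line_def z
      by (intro exI[of _ "int Q"] exI[of _ "int P"] exI[of _ "- int (P * p * a ^ (n - k))"]) simp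
  qed
  have "periodic_orbit (orbit a n z)" if "n \<ge> k" for n
    using odd_line_periodic[OF assms(1) \<open>\<kappa> \<noteq> 0\<close> PQ_pos inw line[OF that]] .
  moreover have "compatible_orbits a k (\<lambda>n. orbit a n z)"
    unfolding compatible_orbits_def using init compatible_self by (intro exI[of _ "\<lambda>_. z"]) blast
  ultimately have "compatible_periodic_orbits a k (\<lambda>n. orbit a n z)"
    by (simp add: compatible_periodic_orbits_def)
  moreover have "orb' n = orbit a n z"
    if orb': "orb' k = orbit a k z" "compatible_orbits a k orb'" and "n \<ge> k" for orb' n
  proof -
    obtain z' where z': "\<And>n. n \<ge> k \<Longrightarrow> orb' n = orbit a n (z' n)"
      "\<And>m n. k \<le> m \<Longrightarrow> m < n \<Longrightarrow> compatible a n m (z' n) (z' m)"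
      using orb'(2) unfolding compatible_orbits_def by blast
    have "orbit a k (z' k) 0 = orbit a k z 0"
      using z'(1)[of k] orb'(1) by simp
    then have "z' k = z"
      by simp
    moreover have "z' n = z" if "n > k"
      using z'(2)[of k n] that \<open>z' k = z\<close> init[of n]
      by (intro compatible_unique) (auto simp: initial_condition_def split: prod.splits)
    ultimately show ?thesis
      using z'(1)[OF \<open>n \<ge> k\<close>] \<open>n \<ge> k\<close> by (cases "n = k") auto
  qed
  ultimately show ?thesis
    by (intro exI[of _ "\<lambda>n. orbit a n z"]) simp
qed

end
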